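(* Let $c \in \mathbb{C}$ be arbitrary, let $P(t) = \sum_{j=0}^{d} \pi_j t^j$ be a polynomial with complex coefficients and $\pi_d \neq 0$, and let $u(x)$ be a solution of the ordinary differential equation $$u''u - (u')^2 = e^{-x}P(u) - 1$$ admitting a formal series of the form $$u(x) = \sum_{k=0}^{\infty} p_k(x+c)e^{-kx},$$ where the $p_k$ are polynomials with complex coefficients and $p_0(x) = x$. Then for all $k$ the degree of $p_k$ equals $d_k = k(d-2)+1$, and the leading coefficient of $p_k$ (the coefficient at $x^{d_k}$ in $p_k(x)$) is $$c_{k,d_k} = \frac{\pi_d^k \cdot \prod_{l=0}^{k-1}\left(1 + \frac{(d-2)l}{2}\right)}{k!}.$$
   Context: That a solution admits a formal series $\sum_{k\ge 0} p_k(x+c)e^{-kx}$ is understood formally: the series, substituted into the differential equation (with termwise differentiation, and with products and powers expanded as Cauchy products), satisfies it identically as a formal series in $e^{-x}$ with coefficients polynomial in $x$. That is, for every integer $s \ge 0$ the polynomial coefficients of $e^{-sx}$ on both sides coincide. No convergence of the series is assumed. The empty product equals $1$. *)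

theory Defs
  imports Complex_Main
    "HOL-Computational_Algebra.Polynomial"
    "HOL-Computational_Algebra.Formal_Power_Series"
begin

text \<open>
  A formal series \<open>\<Sum>k. q\<^sub>k(x) e\<^sup>-\<^sup>k\<^sup>x\<close> with polynomial coefficients is an element of
  \<^typ>\<open>complex poly fps\<close>: the formal variable \<^term>\<open>fps_X\<close> stands for \<open>e\<^sup>-\<^sup>x\<close>, the polynomial
  variable is \<open>x\<close>. Multiplication of power series is then the Cauchy product, and equality
  is equality of the polynomial coefficients of \<open>e\<^sup>-\<^sup>s\<^sup>x\<close> for every \<open>s\<close>.
\<close>

text \<open>Termwise \<open>d/dx\<close>: \<open>(q(x) e\<^sup>-\<^sup>k\<^sup>x)' = (q'(x) - k q(x)) e\<^sup>-\<^sup>k\<^sup>x\<close>. This is not \<^const>\<open>fps_deriv\<close>.\<close>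

definition expser_deriv :: "complex poly fps \<Rightarrow> complex poly fps" where
  "expser_deriv f = Abs_fps (\<lambda>k. pderiv (fps_nth f k) - of_nat k * fps_nth f k)"

definition poly_subst :: "complex poly \<Rightarrow> complex poly fps \<Rightarrow> complex poly fps" where
  "poly_subst P f = (\<Sum>j\<le>degree P. fps_const [:coeff P j:] * f ^ j)"

definition formal_solution :: "complex poly \<Rightarrow> complex poly fps \<Rightarrow> bool" where
  "formal_solution P u \<longleftrightarrow>
     expser_deriv (expser_deriv u) * u - (expser_deriv u)\<^sup>2 = fps_X * poly_subst P u - 1"

text \<open>The series \<open>\<Sum>k. p\<^sub>k(x + c) e\<^sup>-\<^sup>k\<^sup>x\<close>.\<close>

definition shifted_series :: "complex \<Rightarrow> (nat \<Rightarrow> complex poly) \<Rightarrow> complex poly fps" where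
  "shifted_series c p = Abs_fps (\<lambda>k. pcompose (p k) [:c, 1:])"

end

theory Submission imports Defs begin

text \<open>
  Put \<open>n = d - 2\<close>, possibly negative. The claim is that a point \<open>(k, i)\<close> with
  \<open>x\<^sup>i e\<^sup>-\<^sup>k\<^sup>x\<close> occurring in \<open>u\<close> lies on or below the line \<open>i = n k + 1\<close>, and it asks for
  the coefficients on that line. The shift by \<open>c\<close> changes neither degrees nor leading coefficients,
  so it suffices to treat \<open>u\<^sub>k(x) = p\<^sub>k(x + c)\<close>. Call the generating function \<open>C(z)\<close> of the coefficients on a
  bounding line the symbol of the series. Symbols behave like leading coefficients: the symbol of a
  product is the product of the symbols, and \<open>d/dx\<close> acts on symbols as \<open>-z d/dz\<close>, because
  differentiating a polynomial lowers its degree while differentiating \<open>e\<^sup>-\<^sup>k\<^sup>x\<close> does not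
  (\<open>below_line_mult\<close>, \<open>below_line_expser_deriv\<close>). The slope \<open>d - 2\<close> is the one for which both
  sides of the equation have the same bounding line \<open>i = n k + 2\<close>: on the right, multiplication
  by \<open>e\<^sup>-\<^sup>x\<close> turns the line of height \<open>d\<close> that bounds \<open>u\<^sup>d\<close> into one of height \<open>d - n\<close>.

  The bound on \<open>u\<close> is proved by induction on \<open>k\<close>. The coefficient \<open>u\<^sub>s\<close> enters the coefficient of
  \<open>e\<^sup>-\<^sup>s\<^sup>x\<close> in the equation only through a linear operator that raises the degree by exactly one
  (\<open>linearisation_raises_degree\<close>), and what remains is the expression for the truncated series, which
  is known to lie below the line \<open>n k + 2\<close> (\<open>solution_below_line\<close>).

  Reading the equation on the line gives, with \<open>\<theta> = z d/dz\<close> and \<open>\<pi> = \<pi>\<^sub>d\<close>,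
  \<open>\<theta>\<^sup>2C \<cdot> C - (\<theta>C)\<^sup>2 = \<pi> z C\<^sup>d\<close> and \<open>C(0) = 1\<close>. This determines \<open>C\<close>, and with
  \<open>a = (d - 2)/2\<close> its solution is \<open>C = (1 - a \<pi> z)\<^sup>-\<^sup>1\<^sup>/\<^sup>a\<close> (read as \<open>exp (\<pi> z)\<close> for \<open>a = 0\<close>):
  indeed \<open>\<theta> log C = \<pi> z / (1 - a \<pi> z)\<close> and \<open>\<theta>\<^sup>2 log C = \<pi> z / (1 - a \<pi> z)\<^sup>2 = \<pi> z C\<^sup>d\<^sup>-\<^sup>2\<close>.
  Its coefficients are the stated ones.

  For \<open>d \<ge> 2\<close> they are nonzero, so the bound on the degree is attained. For \<open>d = 1\<close> and \<open>d = 0\<close>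
  the line drops below zero, at \<open>k = 2\<close> and at \<open>k = 1\<close> respectively, where the closed form
  still gives a nonzero coefficient. So in these two cases there is no formal solution at all.
\<close>

section \<open>The bilinear expression and its linearisation\<close>

text \<open>
  Both \<open>d/dx\<close> on exponential series and its counterpart \<open>-z d/dz\<close> on symbols act on each coefficient
  separately. The common form allows one linearisation lemma for both.
\<close>

definition coeffwise :: "(nat \<Rightarrow> 'a \<Rightarrow> 'a) \<Rightarrow> 'a::zero fps \<Rightarrow> 'a fps" where
  "coeffwise \<delta> f = Abs_fps (\<lambda>k. \<delta> k (fps_nth f k))"

definition bilinear_form :: "('a fps \<Rightarrow> 'a fps) \<Rightarrow> 'a::comm_ring_1 fps \<Rightarrow> 'a fps" where
  "bilinear_form D f = D (D f) * f - (D f)\<^sup>2"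

lemma expser_deriv_coeffwise:
  "expser_deriv = coeffwise (\<lambda>k q. pderiv q - of_nat k * q)"
  by (rule ext) (simp add: expser_deriv_def coeffwise_def)

abbreviation symbol_deriv :: "complex fps \<Rightarrow> complex fps" where
  "symbol_deriv \<equiv> coeffwise (\<lambda>k y. - (of_nat k * y))"

lemma symbol_deriv_eq: "symbol_deriv f = - (fps_X * fps_deriv f)"
  by (rule fps_ext) (simp add: coeffwise_def)

lemma fps_mult_nth_low:
  fixes f g :: "'a::comm_ring_1 fps"
  assumes "\<And>k. k < s \<Longrightarrow> fps_nth g k = 0"
  shows "fps_nth (f * g) s = fps_nth f 0 * fps_nth g s"
proof -
  have "fps_nth (f * g) s = (\<Sum>i=0..s. if i = 0 then fps_nth f 0 * fps_nth g s else 0)"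
    unfolding fps_mult_nth by (rule sum.cong) (auto simp: assms)
  then show ?thesis by simp
qed

text \<open>
  Write \<open>f = g + r\<close> with \<open>r\<close> starting at order \<open>s\<close>: in the coefficient of order \<open>s\<close>, the part that is
  quadratic in \<open>r\<close> has order \<open>2s\<close> and disappears, and the mixed terms see only the constant
  coefficient of \<open>g\<close>.
\<close>

lemma bilinear_form_linearisation:
  fixes f g :: "'a::comm_ring_1 fps"
  assumes add: "\<And>k x y. \<delta> k (x + y) = \<delta> k x + \<delta> k y"
    and "0 < s" and agree: "\<And>k. k < s \<Longrightarrow> fps_nth f k = fps_nth g k"
    and a: "fps_nth g 0 = a" and r: "fps_nth f s - fps_nth g s = r"
  shows "fps_nth (bilinear_form (coeffwise \<delta>) f) s - fps_nth (bilinear_form (coeffwise \<delta>) g) s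
    = a * \<delta> s (\<delta> s r) + \<delta> 0 (\<delta> 0 a) * r - 2 * \<delta> 0 a * \<delta> s r"
proof -
  define D where "D = coeffwise \<delta>"
  define h where "h = f - g"
  have zero: "\<delta> k 0 = 0" for k using add[of k 0 0] by simp
  have D_add: "D (x + y) = D x + D y" for x y
    by (rule fps_ext) (simp add: D_def coeffwise_def add)
  have f: "f = g + h" by (simp add: h_def)
  have h_low: "fps_nth h k = 0" if "k < s" for k using that agree by (simp add: h_def)
  have Dh_low: "fps_nth (D h) k = 0" if "k < s" for k
    using that h_low by (simp add: D_def coeffwise_def zero)
  have DDh_low: "fps_nth (D (D h)) k = 0" if "k < s" for k
    using that Dh_low by (simp add: D_def coeffwise_def zero)
  have hs: "fps_nth h s = r" using r by (simp add: h_def)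
  have expand: "bilinear_form D f - bilinear_form D g
      = g * D (D h) + D (D g) * h - 2 * (D g * D h) + (D (D h) * h - D h * D h)"
    unfolding bilinear_form_def f D_add by (simp add: algebra_simps power2_eq_square)
  have dbl: "fps_nth (2 * x) s = 2 * fps_nth x s" for x :: "'a fps"
    by (simp only: mult_2 fps_add_nth)
  have "fps_nth (bilinear_form D f - bilinear_form D g) s
      = fps_nth g 0 * fps_nth (D (D h)) s + fps_nth (D (D g)) 0 * fps_nth h s
        - 2 * (fps_nth (D g) 0 * fps_nth (D h) s)
        + (fps_nth (D (D h)) 0 * fps_nth h s - fps_nth (D h) 0 * fps_nth (D h) s)"
    unfolding expand
    by (simp only: fps_add_nth fps_sub_nth dbl fps_mult_nth_low[OF h_low]
        fps_mult_nth_low[OF Dh_low] fps_mult_nth_low[OF DDh_low])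
  also have "\<dots> = a * \<delta> s (\<delta> s r) + \<delta> 0 (\<delta> 0 a) * r - 2 * \<delta> 0 a * \<delta> s r"
    using Dh_low[OF \<open>0 < s\<close>] DDh_low[OF \<open>0 < s\<close>]
    by (simp add: hs D_def coeffwise_def a mult.assoc)
  finally show ?thesis by (simp add: D_def)
qed

lemma fps_mult_agree:
  fixes f g f' g' :: "'a::comm_ring_1 fps"
  assumes "\<And>k. k < s \<Longrightarrow> fps_nth f k = fps_nth f' k"
    and "\<And>k. k < s \<Longrightarrow> fps_nth g k = fps_nth g' k" and "k < s"
  shows "fps_nth (f * g) k = fps_nth (f' * g') k"
  unfolding fps_mult_nth by (rule sum.cong) (use assms in auto)

lemma fps_power_agree:
  fixes f f' :: "'a::comm_ring_1 fps"
  assumes "\<And>k. k < s \<Longrightarrow> fps_nth f k = fps_nth f' k" and "k < s"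
  shows "fps_nth (f ^ j) k = fps_nth (f' ^ j) k"
  using assms(2)
proof (induction j arbitrary: k)
  case (Suc j)
  then show ?case using assms(1) by (simp add: fps_mult_agree[of s f f'])
qed simp

lemma poly_subst_agree:
  assumes "\<And>k. k < s \<Longrightarrow> fps_nth f k = fps_nth g k" and "k < s"
  shows "fps_nth (poly_subst P f) k = fps_nth (poly_subst P g) k"
  unfolding poly_subst_def fps_sum_nth
  by (rule sum.cong) (use fps_power_agree[OF assms] in auto)

section \<open>Series below a line and their symbols\<close>

text \<open>
  The bounds are integers and may be negative, and then they force the polynomial to be zero. This
  is what makes \<open>d < 2\<close> accessible to the same argument as \<open>d \<ge> 2\<close>.
\<close>

definition degree_at_most :: "'a::zero poly \<Rightarrow> int \<Rightarrow> bool" where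
  "degree_at_most q e \<longleftrightarrow> (\<forall>i. e < int i \<longrightarrow> coeff q i = 0)"

definition int_coeff :: "'a::zero poly \<Rightarrow> int \<Rightarrow> 'a" where
  "int_coeff q e = (if 0 \<le> e then coeff q (nat e) else 0)"

lemma degree_at_most_neg: "degree_at_most q e \<Longrightarrow> e < 0 \<Longrightarrow> q = 0"
  by (rule poly_eqI) (auto simp: degree_at_most_def)

lemma degree_at_most_iff: "degree_at_most q e \<longleftrightarrow> q = 0 \<or> int (degree q) \<le> e"
proof
  assume "degree_at_most q e"
  then show "q = 0 \<or> int (degree q) \<le> e"
    by (metis degree_at_most_def leading_coeff_0_iff not_le)
next
  assume "q = 0 \<or> int (degree q) \<le> e"
  then show "degree_at_most q e"
    by (auto simp: degree_at_most_def intro: coeff_eq_0)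
qed

lemma degree_at_most_mult:
  fixes p q :: "'a::comm_ring_1 poly"
  assumes "degree_at_most p e" "degree_at_most q e'"
  shows "degree_at_most (p * q) (e + e')"
proof (cases "p = 0 \<or> q = 0")
  case False
  then have "int (degree p) \<le> e" "int (degree q) \<le> e'"
    using assms by (auto simp: degree_at_most_iff)
  then have "int (degree (p * q)) \<le> e + e'"
    using degree_mult_le[of p q] by linarith
  then show ?thesis by (simp add: degree_at_most_iff)
qed (auto simp: degree_at_most_def)

lemma int_coeff_mult:
  fixes p q :: "'a::comm_ring_1 poly"
  assumes "degree_at_most p e" "degree_at_most q e'"
  shows "int_coeff (p * q) (e + e') = int_coeff p e * int_coeff q e'"
proof (cases "e < 0 \<or> e' < 0")
  case True
  then have "p * q = 0" using assms degree_at_most_neg by fastforce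
  then show ?thesis using True by (auto simp: int_coeff_def)
next
  case False
  define E E' where "E = nat e" and "E' = nat e'"
  have e: "e = int E" "e' = int E'" using False by (auto simp: E_def E'_def)
  have "coeff (p * q) (E + E') = (\<Sum>i\<le>E + E'. if i = E then coeff p E * coeff q E' else 0)"
    unfolding coeff_mult
  proof (rule sum.cong)
    fix i assume "i \<in> {..E + E'}"
    then have "i < E \<Longrightarrow> E' < E + E' - i" by auto
    then show "coeff p i * coeff q (E + E' - i) = (if i = E then coeff p E * coeff q E' else 0)"
      using assms unfolding e degree_at_most_def by (cases i E rule: linorder_cases) auto
  qed simp
  then have "coeff (p * q) (E + E') = coeff p E * coeff q E'" by simp
  moreover have "nat (int E + int E') = E + E'" by simp
  ultimately show ?thesis by (simp add: int_coeff_def e)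
qed

lemma degree_at_most_sum: "(\<And>i. i \<in> A \<Longrightarrow> degree_at_most (f i) e) \<Longrightarrow> degree_at_most (sum f A) e"
  by (simp add: degree_at_most_def coeff_sum)

lemma int_coeff_sum: "int_coeff (sum f A) e = (\<Sum>i\<in>A. int_coeff (f i) e)"
  by (simp add: int_coeff_def coeff_sum)

definition below_line :: "int \<Rightarrow> int \<Rightarrow> complex poly fps \<Rightarrow> bool" where
  "below_line n m f \<longleftrightarrow> (\<forall>k. degree_at_most (fps_nth f k) (n * int k + m))"

definition symbol :: "int \<Rightarrow> int \<Rightarrow> complex poly fps \<Rightarrow> complex fps" where
  "symbol n m f = Abs_fps (\<lambda>k. int_coeff (fps_nth f k) (n * int k + m))"

lemma line_add: "i \<le> k \<Longrightarrow> (n * int i + m) + (n * int (k - i) + m') = n * int k + (m + m')"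
  by (simp add: algebra_simps)

text \<open>
  Heights of lines of equal slope add, so every Cauchy summand reaches the line of the product only
  through its two extreme coefficients.
\<close>

lemma below_line_mult:
  assumes "below_line n m f" "below_line n m' g"
  shows "below_line n (m + m') (f * g)"
    and "symbol n (m + m') (f * g) = symbol n m f * symbol n m' g"
proof -
  have deg: "degree_at_most (fps_nth f i) (n * int i + m)"
      "degree_at_most (fps_nth g i) (n * int i + m')" for i :: nat
    using assms by (auto simp: below_line_def)
  show "below_line n (m + m') (f * g)"
    unfolding below_line_def fps_mult_nth
  proof (intro allI degree_at_most_sum)
    fix k i :: nat assume "i \<in> {0..k}"
    then show "degree_at_most (fps_nth f i * fps_nth g (k - i)) (n * int k + (m + m'))"
      using degree_at_most_mult[OF deg(1)[of i] deg(2)[of "k - i"]]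
      by (simp only: line_add atLeastAtMost_iff)
  qed
  show "symbol n (m + m') (f * g) = symbol n m f * symbol n m' g"
  proof (rule fps_ext)
    fix k
    have "int_coeff (fps_nth f i * fps_nth g (k - i)) (n * int k + (m + m'))
        = int_coeff (fps_nth f i) (n * int i + m) * int_coeff (fps_nth g (k - i)) (n * int (k - i) + m')"
      if "i \<in> {0..k}" for i
      using int_coeff_mult[OF deg(1)[of i] deg(2)[of "k - i"]] that
      by (simp only: line_add atLeastAtMost_iff)
    then show "fps_nth (symbol n (m + m') (f * g)) k = fps_nth (symbol n m f * symbol n m' g) k"
      by (simp add: symbol_def fps_mult_nth int_coeff_sum)
  qed
qed

lemma below_line_diff:
  assumes "below_line n m f" "below_line n m g"
  shows "below_line n m (f - g)" and "symbol n m (f - g) = symbol n m f - symbol n m g"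
  using assms
  by (auto simp: below_line_def degree_at_most_def symbol_def int_coeff_def fps_eq_iff)

lemma below_line_sum:
  assumes "\<And>i. i \<in> A \<Longrightarrow> below_line n m (f i)"
  shows "below_line n m (sum f A)" and "symbol n m (sum f A) = (\<Sum>i\<in>A. symbol n m (f i))"
  using assms
  by (auto simp: below_line_def symbol_def int_coeff_sum fps_eq_iff fps_sum_nth
      intro: degree_at_most_sum)

lemma below_line_mono:
  assumes "below_line n m f" "m < m'"
  shows "below_line n m' f" and "symbol n m' f = 0"
  using assms
  by (auto simp: below_line_def degree_at_most_def symbol_def int_coeff_def fps_eq_iff)

lemma below_line_const:
  shows "below_line n 0 (fps_const [:y:])" and "symbol n 0 (fps_const [:y:]) = fps_const y"
  by (auto simp: below_line_def degree_at_most_def symbol_def int_coeff_def fps_eq_iff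
      coeff_pCons split: nat.split)

lemma below_line_power:
  assumes "below_line n 1 f"
  shows "below_line n (int j) (f ^ j) \<and> symbol n (int j) (f ^ j) = symbol n 1 f ^ j"
proof (induction j)
  case 0
  then show ?case using below_line_const[of n 1] by (simp add: one_pCons[symmetric])
next
  case (Suc j)
  then show ?case using below_line_mult[OF assms, of "int j" "f ^ j"] by simp
qed

lemma below_line_fps_X:
  assumes "below_line n m f"
  shows "below_line n (m - n) (fps_X * f)" and "symbol n (m - n) (fps_X * f) = fps_X * symbol n m f"
proof -
  have line: "n * int (Suc k) + (m - n) = n * int k + m" for k
    by (simp add: algebra_simps)
  show "below_line n (m - n) (fps_X * f)"
    unfolding below_line_def
  proof
    fix k
    show "degree_at_most (fps_nth (fps_X * f) k) (n * int k + (m - n))"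
    proof (cases k)
      case (Suc j)
      then show ?thesis using assms by (simp only: line) (simp add: below_line_def)
    qed (simp add: degree_at_most_def)
  qed
  show "symbol n (m - n) (fps_X * f) = fps_X * symbol n m f"
  proof (rule fps_ext)
    fix k
    show "fps_nth (symbol n (m - n) (fps_X * f)) k = fps_nth (fps_X * symbol n m f) k"
    proof (cases k)
      case (Suc j)
      then show ?thesis by (simp only: symbol_def fps_nth_Abs_fps line) (simp add: symbol_def)
    qed (simp add: symbol_def int_coeff_def)
  qed
qed

lemma below_line_expser_deriv:
  assumes "below_line n m f"
  shows "below_line n m (expser_deriv f)"
    and "symbol n m (expser_deriv f) = symbol_deriv (symbol n m f)"
proof -
  have c: "coeff (of_nat k * q) i = of_nat k * coeff q i" for k i and q :: "complex poly"
    by (simp add: of_nat_poly)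
  show "below_line n m (expser_deriv f)"
    using assms by (auto simp: below_line_def degree_at_most_def expser_deriv_def coeff_pderiv c)
  have vanish: "coeff (fps_nth f k) (Suc (nat e)) = 0" if "n * int k + m = e" "0 \<le> e" for k e
    using assms that by (auto simp: below_line_def degree_at_most_def)
  show "symbol n m (expser_deriv f) = symbol_deriv (symbol n m f)"
    by (rule fps_ext)
      (auto simp: symbol_def int_coeff_def expser_deriv_def coeffwise_def coeff_pderiv c vanish)
qed

lemma below_line_bilinear_form:
  assumes "below_line n 1 f"
  shows "below_line n 2 (bilinear_form expser_deriv f)"
    and "symbol n 2 (bilinear_form expser_deriv f) = bilinear_form symbol_deriv (symbol n 1 f)"
proof -
  note 1 = below_line_expser_deriv[OF assms]
  note 2 = below_line_expser_deriv[OF 1(1)]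
  note 3 = below_line_mult[OF 2(1) assms]
  note 4 = below_line_mult[OF 1(1) 1(1)]
  show "below_line n 2 (bilinear_form expser_deriv f)"
    using below_line_diff(1)[OF 3(1) 4(1)] by (simp add: bilinear_form_def power2_eq_square)
  show "symbol n 2 (bilinear_form expser_deriv f) = bilinear_form symbol_deriv (symbol n 1 f)"
    using below_line_diff(2)[OF 3(1) 4(1)] 3(2) 4(2)
    by (simp add: bilinear_form_def power2_eq_square 1(2) 2(2))
qed

text \<open>The powers \<open>f\<^sup>j\<close> with \<open>j < degree P\<close> stay strictly below the line of height \<open>degree P\<close>.\<close>

lemma below_line_poly_subst:
  assumes "below_line n 1 f"
  shows "below_line n (int (degree P)) (poly_subst P f)"
    and "symbol n (int (degree P)) (poly_subst P f)
      = fps_const (lead_coeff P) * symbol n 1 f ^ degree P"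
proof -
  let ?t = "\<lambda>j. fps_const [:coeff P j:] * f ^ j"
  have t: "below_line n (int j) (?t j)"
      "symbol n (int j) (?t j) = fps_const (coeff P j) * symbol n 1 f ^ j" for j
    using below_line_mult[OF below_line_const(1)[of n "coeff P j"], of "int j" "f ^ j"]
      below_line_power[OF assms, of j]
    by (simp_all add: below_line_const(2))
  have bd: "below_line n (int (degree P)) (?t j)" if "j \<in> {..degree P}" for j
    using t(1)[of j] below_line_mono(1)[OF t(1)[of j], of "int (degree P)"] that
    by (cases "j = degree P") auto
  show "below_line n (int (degree P)) (poly_subst P f)"
    unfolding poly_subst_def by (rule below_line_sum(1)) (rule bd)
  have "symbol n (int (degree P)) (poly_subst P f)
      = (\<Sum>j\<le>degree P. symbol n (int (degree P)) (?t j))"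
    unfolding poly_subst_def by (rule below_line_sum(2)) (rule bd)
  also have "\<dots> = (\<Sum>j\<le>degree P. if j = degree P
      then fps_const (lead_coeff P) * symbol n 1 f ^ degree P else 0)"
    using t(2)[of "degree P"] below_line_mono(2)[OF t(1), of _ "int (degree P)"]
    by (intro sum.cong) auto
  finally show "symbol n (int (degree P)) (poly_subst P f)
      = fps_const (lead_coeff P) * symbol n 1 f ^ degree P"
    by simp
qed

section \<open>The symbol equation\<close>

lemma linear_fps_ode_unique:
  fixes f g :: "complex fps"
  assumes "(1 - fps_const b * fps_X) * fps_deriv f = fps_const \<kappa> * f"
    and "(1 - fps_const b * fps_X) * fps_deriv g = fps_const \<kappa> * g"
    and "fps_nth f 0 = fps_nth g 0"
  shows "f = g"
proof -
  have rec: "of_nat (Suc k) * fps_nth h (Suc k) = (b * of_nat k + \<kappa>) * fps_nth h k"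
    if "(1 - fps_const b * fps_X) * fps_deriv h = fps_const \<kappa> * h" for k and h :: "complex fps"
    using arg_cong[OF that, of "\<lambda>F. fps_nth F k"]
    by (cases k) (simp_all add: algebra_simps)
  have "fps_nth f k = fps_nth g k" for k
  proof (induction k)
    case (Suc k)
    then have "of_nat (Suc k) * fps_nth f (Suc k) = of_nat (Suc k) * fps_nth g (Suc k)"
      using rec[OF assms(1), of k] rec[OF assms(2), of k] by simp
    then show ?case by (simp del: of_nat_Suc)
  qed (rule assms(3))
  then show ?thesis by (simp add: fps_eq_iff)
qed

text \<open>For \<open>a \<noteq> 0\<close> this is the expansion of \<open>(1 - a \<kappa> z)\<^sup>-\<^sup>1\<^sup>/\<^sup>a\<close>, and for \<open>a = 0\<close> of \<open>exp (\<kappa> z)\<close>.\<close>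

definition symbol_solution :: "complex \<Rightarrow> complex \<Rightarrow> complex fps" where
  "symbol_solution a \<kappa> = Abs_fps (\<lambda>k. \<kappa> ^ k * (\<Prod>l<k. 1 + a * of_nat l) / fact k)"

lemma symbol_solution_deriv:
  "(1 - fps_const (a * \<kappa>) * fps_X) * fps_deriv (symbol_solution a \<kappa>)
    = fps_const \<kappa> * symbol_solution a \<kappa>"
proof (rule fps_ext)
  fix k
  let ?c = "\<lambda>k. fps_nth (symbol_solution a \<kappa>) k"
  have rec: "of_nat (Suc k) * ?c (Suc k) = \<kappa> * (1 + a * of_nat k) * ?c k" for k
    by (simp add: symbol_solution_def field_simps del: of_nat_Suc)
  show "fps_nth ((1 - fps_const (a * \<kappa>) * fps_X) * fps_deriv (symbol_solution a \<kappa>)) k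
      = fps_nth (fps_const \<kappa> * symbol_solution a \<kappa>) k"
    using rec[of k] by (cases k) (simp_all add: algebra_simps)
qed

text \<open>
  Here \<open>w = 1 - a \<kappa> z\<close> stands for \<open>C\<^sup>-\<^sup>a\<close>. The relation \<open>C\<^sup>d w\<^sup>2 = C\<^sup>2\<close> replaces
  \<open>w\<^sup>-\<^sup>2 = C\<^sup>d\<^sup>-\<^sup>2\<close>, in which the exponent is negative for \<open>d < 2\<close>. It holds because both sides solve
  the equation \<open>w F' = 2 \<kappa> F\<close>.
\<close>

lemma symbol_solution_ode:
  fixes d :: nat and \<kappa> :: complex
  defines "a \<equiv> (of_nat d - 2) / 2"
  defines "C \<equiv> symbol_solution a \<kappa>"
  shows "bilinear_form symbol_deriv C = fps_X * (fps_const \<kappa> * C ^ d)"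
proof -
  define w where "w = 1 - fps_const (a * \<kappa>) * fps_X"
  define K where "K = fps_const \<kappa>"
  define A where "A = fps_const a"
  have AK: "fps_const (a * \<kappa>) = A * K" by (simp add: A_def K_def)
  have w: "w = 1 - A * K * fps_X" by (simp add: w_def AK)
  have dw: "fps_deriv w = - (A * K)" unfolding w by (simp add: A_def K_def)
  have wC: "w * fps_deriv C = K * C"
    using symbol_solution_deriv[of a \<kappa>] by (simp add: w_def K_def C_def)
  have C0: "fps_nth C 0 = 1" by (simp add: C_def symbol_solution_def)
  have dK: "of_nat d * K - 2 * A * K = 2 * K"
  proof -
    have "of_nat d - 2 * A = (2 :: complex fps)"
      by (rule fps_ext) (simp add: A_def a_def fps_of_nat[symmetric] fps_numeral_fps_const field_simps)
    then show ?thesis by (metis left_diff_distrib)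
  qed
  have two: "2 * K = fps_const (2 * \<kappa>)"
    by (simp add: K_def fps_numeral_fps_const)
  have Cd: "C ^ d * w\<^sup>2 = C\<^sup>2"
  proof (rule linear_fps_ode_unique)
    have pow: "w * fps_deriv (C ^ j) = of_nat j * K * C ^ j" for j
    proof (induction j)
      case (Suc j)
      have "w * fps_deriv (C ^ Suc j) = (w * fps_deriv C) * C ^ j + C * (w * fps_deriv (C ^ j))"
        by (simp only: power_Suc fps_deriv_mult algebra_simps)
      then show ?case by (simp add: wC Suc algebra_simps)
    qed simp
    have "w * fps_deriv (C ^ d * w\<^sup>2) = (w * fps_deriv (C ^ d)) * w\<^sup>2 + C ^ d * 2 * w\<^sup>2 * fps_deriv w"
      by (simp add: power2_eq_square algebra_simps)
    also have "\<dots> = (of_nat d * K - 2 * A * K) * (C ^ d * w\<^sup>2)"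
      by (simp add: pow dw algebra_simps)
    finally show "(1 - fps_const (a * \<kappa>) * fps_X) * fps_deriv (C ^ d * w\<^sup>2)
        = fps_const (2 * \<kappa>) * (C ^ d * w\<^sup>2)"
      by (simp only: dK two w_def)
    have "w * fps_deriv (C\<^sup>2) = 2 * K * C\<^sup>2" using pow[of 2] by simp
    then show "(1 - fps_const (a * \<kappa>) * fps_X) * fps_deriv (C\<^sup>2) = fps_const (2 * \<kappa>) * C\<^sup>2"
      by (simp only: two w_def)
    show "fps_nth (C ^ d * w\<^sup>2) 0 = fps_nth (C\<^sup>2) 0"
      by (simp add: fps_nth_power_0 C0 w_def)
  qed
  define C1 C2 where "C1 = fps_deriv C" and "C2 = fps_deriv C1"
  have wC1: "w * C1 = K * C" using wC by (simp add: C1_def)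
  have wC2: "w * C2 = (1 + A) * K * C1"
  proof -
    have "fps_deriv (w * C1) = fps_deriv (K * C)" by (simp only: wC1)
    then show ?thesis
      by (simp add: dw C1_def[symmetric] C2_def[symmetric] K_def algebra_simps)
  qed
  have form: "bilinear_form symbol_deriv C = fps_X * (C1 * C + fps_X * (C2 * C - C1\<^sup>2))"
    unfolding bilinear_form_def symbol_deriv_eq
    by (simp add: C1_def C2_def power2_eq_square algebra_simps)
  have "w\<^sup>2 * bilinear_form symbol_deriv C
      = fps_X * (w * (w * C1) * C + fps_X * (w * (w * C2) * C - (w * C1)\<^sup>2))"
    unfolding form by (simp add: power2_eq_square algebra_simps)
  also have "\<dots> = fps_X * (w * (K * C) * C
      + fps_X * (w * ((1 + A) * K * C1) * C - (K * C)\<^sup>2))"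
    by (simp only: wC1 wC2)
  also have "\<dots> = fps_X * (w * K * C\<^sup>2 + fps_X * ((1 + A) * K * (w * C1) * C - (K * C)\<^sup>2))"
    by (simp add: power2_eq_square algebra_simps)
  also have "\<dots> = fps_X * (K * C\<^sup>2 * (w + A * K * fps_X))"
    by (simp only: wC1) (simp add: power2_eq_square algebra_simps)
  also have "\<dots> = fps_X * (K * C\<^sup>2)" by (simp add: w)
  also have "\<dots> = w\<^sup>2 * (fps_X * (K * C ^ d))"
    by (simp add: Cd[symmetric] algebra_simps)
  finally have "w\<^sup>2 * bilinear_form symbol_deriv C = w\<^sup>2 * (fps_X * (K * C ^ d))" .
  moreover have "w \<noteq> 0"
  proof
    assume "w = 0"
    then have "fps_nth w 0 = 0" by simp
    then show False by (simp add: w_def)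
  qed
  ultimately show ?thesis by (simp add: K_def)
qed

text \<open>
  The coefficient of order \<open>s\<close> of the unknown series appears in the coefficient of order \<open>s\<close> of the
  equation with the factor \<open>s\<^sup>2\<close> on the left, and not at all on the right.
\<close>

lemma symbol_ode_unique:
  fixes f g :: "complex fps"
  assumes f: "bilinear_form symbol_deriv f = fps_X * (fps_const \<kappa> * f ^ d)" "fps_nth f 0 = 1"
    and g: "bilinear_form symbol_deriv g = fps_X * (fps_const \<kappa> * g ^ d)" "fps_nth g 0 = 1"
  shows "f = g"
proof (rule fps_ext)
  fix s
  show "fps_nth f s = fps_nth g s"
  proof (induction s rule: less_induct)
    case (less s)
    show ?case
    proof (cases "s = 0")
      case False
      have "fps_nth (f ^ d) (s - 1) = fps_nth (g ^ d) (s - 1)"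
        by (rule fps_power_agree[of s]) (use less False in auto)
      then have "fps_nth (bilinear_form symbol_deriv f) s = fps_nth (bilinear_form symbol_deriv g) s"
        using False by (simp add: f(1) g(1))
      moreover have "fps_nth (bilinear_form symbol_deriv f) s
          - fps_nth (bilinear_form symbol_deriv g) s
          = of_nat s * (of_nat s * (fps_nth f s - fps_nth g s))"
        by (subst bilinear_form_linearisation[OF _ _ _ g(2) refl])
          (use False less in \<open>auto simp: algebra_simps\<close>)
      ultimately show ?thesis using False by simp
    qed (simp add: f(2) g(2))
  qed
qed

section \<open>The degree bound and the leading coefficients\<close>

text \<open>
  The extra degree comes from the factor \<open>x\<close> in \<open>u\<^sub>0 = x + c\<close>, multiplied by the term \<open>s\<^sup>2 q\<close> of
  \<open>\<delta> (\<delta> q)\<close>. All other terms have degree at most that of \<open>q\<close>.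
\<close>

lemma linearisation_raises_degree:
  fixes q :: "complex poly" and c :: complex and s :: nat
  defines "\<delta> \<equiv> \<lambda>q. pderiv q - of_nat s * q"
  shows "coeff ([:c, 1:] * \<delta> (\<delta> q) - 2 * \<delta> q) (Suc (degree q)) = (of_nat s)\<^sup>2 * lead_coeff q"
proof -
  have c: "coeff (of_nat k * q) i = of_nat k * coeff q i" for k i and q :: "complex poly"
    by (simp add: of_nat_poly)
  have c2: "coeff (2 * q) i = 2 * coeff q i" for i and q :: "complex poly"
    by (simp only: mult_2 coeff_add)
  have high: "coeff q (Suc (degree q)) = 0" "coeff q (Suc (Suc (degree q))) = 0"
      "coeff q (Suc (Suc (Suc (degree q)))) = 0"
    by (simp_all add: coeff_eq_0)
  show ?thesis
    by (simp add: \<delta>_def c c2 coeff_pderiv high power2_eq_square)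
qed

lemma solution_below_line:
  fixes u :: "complex poly fps"
  assumes sol: "formal_solution P u" and u0: "fps_nth u 0 = [:c, 1:]"
  defines "n \<equiv> int (degree P) - 2"
  shows "below_line n 1 u"
proof -
  have eq: "bilinear_form expser_deriv u = fps_X * poly_subst P u - 1"
    using sol by (simp add: formal_solution_def bilinear_form_def)
  have "degree_at_most (fps_nth u s) (n * int s + 1)" for s
  proof (induction s rule: less_induct)
    case (less s)
    show ?case
    proof (cases "s = 0")
      case True
      then show ?thesis by (simp add: u0 degree_at_most_iff)
    next
      case False
      define v where "v = fps_cutoff s u"
      define q where "q = fps_nth u s"
      define \<delta> where "\<delta> = (\<lambda>q :: complex poly. pderiv q - of_nat s * q)"
      have agree: "fps_nth u k = fps_nth v k" if "k < s" for k using that by (simp add: v_def)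
      have v: "below_line n 1 v"
        using less by (auto simp: below_line_def v_def degree_at_most_def)
      have "degree_at_most (fps_nth (bilinear_form expser_deriv v) s) (n * int s + 2)"
        using below_line_bilinear_form(1)[OF v] by (simp add: below_line_def)
      moreover have "degree_at_most (fps_nth (fps_X * poly_subst P v) s) (n * int s + 2)"
        using below_line_fps_X(1)[OF below_line_poly_subst(1)[OF v, of P]]
        by (simp add: below_line_def n_def)
      moreover have "fps_nth (fps_X * poly_subst P v) s = fps_nth (fps_X * poly_subst P u) s"
        using False poly_subst_agree[OF agree, of s "s - 1" P] by simp
      moreover have "fps_nth (bilinear_form expser_deriv u) s
          - fps_nth (bilinear_form expser_deriv v) s = [:c, 1:] * \<delta> (\<delta> q) - 2 * \<delta> q"
        unfolding expser_deriv_coeffwise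
        by (subst bilinear_form_linearisation[where s = s and a = "[:c, 1:]" and r = q])
          (use agree False u0 in \<open>auto simp: q_def v_def \<delta>_def pderiv_add pderiv_pCons
            distrib_left one_pCons[symmetric]\<close>)
      moreover have "fps_nth (bilinear_form expser_deriv u) s = fps_nth (fps_X * poly_subst P u) s"
        using False by (simp add: eq)
      ultimately have *: "degree_at_most ([:c, 1:] * \<delta> (\<delta> q) - 2 * \<delta> q) (n * int s + 2)"
        by (metis (no_types, lifting) coeff_diff degree_at_most_def diff_zero)
      show ?thesis
      proof (cases "q = 0")
        case True
        then show ?thesis by (simp add: q_def degree_at_most_def)
      next
        case q: False
        then have "coeff ([:c, 1:] * \<delta> (\<delta> q) - 2 * \<delta> q) (Suc (degree q)) \<noteq> 0"
          unfolding \<delta>_def linearisation_raises_degree using False by simp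
        then have "int (Suc (degree q)) \<le> n * int s + 2"
          using * unfolding degree_at_most_def by (meson not_less)
        then show ?thesis by (simp add: q_def degree_at_most_iff)
      qed
    qed
  qed
  then show ?thesis by (simp add: below_line_def)
qed

lemma solution_symbol:
  fixes u :: "complex poly fps"
  assumes sol: "formal_solution P u" and u0: "fps_nth u 0 = [:c, 1:]"
  defines "n \<equiv> int (degree P) - 2"
  shows "symbol n 1 u = symbol_solution ((of_nat (degree P) - 2) / 2) (lead_coeff P)"
proof (rule symbol_ode_unique)
  let ?C = "symbol n 1 u"
  have u: "below_line n 1 u" using solution_below_line[OF sol u0] by (simp add: n_def)
  have one: "below_line n 2 1" "symbol n 2 1 = 0"
    using below_line_mono[OF below_line_const(1)[of n 1], of 2] by (simp_all add: one_pCons[symmetric])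
  note S = below_line_poly_subst[OF u, of P]
  have h: "int (degree P) - n = 2" by (simp add: n_def)
  note X = below_line_fps_X[OF S(1), unfolded h S(2)]
  have "bilinear_form expser_deriv u = fps_X * poly_subst P u - 1"
    using sol by (simp add: formal_solution_def bilinear_form_def)
  then have "symbol n 2 (bilinear_form expser_deriv u)
      = fps_X * (fps_const (lead_coeff P) * ?C ^ degree P)"
    using below_line_diff(2)[OF X(1) one(1)] X(2) one(2) by simp
  then show "bilinear_form symbol_deriv ?C = fps_X * (fps_const (lead_coeff P) * ?C ^ degree P)"
    by (simp only: below_line_bilinear_form(2)[OF u])
  show "fps_nth ?C 0 = 1" by (simp add: symbol_def int_coeff_def u0)
  show "fps_nth (symbol_solution ((of_nat (degree P) - 2) / 2) (lead_coeff P)) 0 = 1"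
    by (simp add: symbol_solution_def)
qed (rule symbol_solution_ode)

text \<open>
  If the line is negative at \<open>k\<close>, the symbol vanishes there. The closed form vanishes at \<open>k\<close>
  only if \<open>1 + (d - 2) l / 2 = 0\<close> for some \<open>l < k\<close>, that is \<open>l = 2\<close> for \<open>d = 1\<close> and \<open>l = 1\<close> for
  \<open>d = 0\<close>, one step after the line has become negative.
\<close>

lemma formal_solution_degree_ge_2:
  assumes "formal_solution P u" "fps_nth u 0 = [:c, 1:]" "P \<noteq> 0"
  shows "2 \<le> degree P"
proof (rule ccontr)
  assume "\<not> 2 \<le> degree P"
  then consider "degree P = 0" | "degree P = 1" by linarith
  then show False
  proof cases
    case 1
    have "fps_nth (symbol (-2) 1 u) 1 = lead_coeff P"
      using solution_symbol[OF assms(1,2)] 1 by (simp add: symbol_solution_def)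
    then show False using \<open>P \<noteq> 0\<close> by (simp add: symbol_def int_coeff_def)
  next
    case 2
    have "fps_nth (symbol (-1) 1 u) 2 = (lead_coeff P)\<^sup>2 * (1 / 2) / 2"
      using solution_symbol[OF assms(1,2)] 2
      by (simp add: symbol_solution_def lessThan_nat_numeral numeral_2_eq_2)
    then show False using \<open>P \<noteq> 0\<close> by (simp add: symbol_def int_coeff_def)
  qed
qed

theorem lemma5p3:
  fixes c :: complex and d :: nat and \<pi> :: "nat \<Rightarrow> complex"
    and P :: "complex poly" and p :: "nat \<Rightarrow> complex poly"
  assumes "P = (\<Sum>j\<le>d. monom (\<pi> j) j)"
    and "\<pi> d \<noteq> 0"
    and "p 0 = [:0, 1:]"
    and "formal_solution P (shifted_series c p)"
  shows "\<forall>k. p k \<noteq> 0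
           \<and> int (degree (p k)) = int k * (int d - 2) + 1
           \<and> coeff (p k) (nat (int k * (int d - 2) + 1)) =
               \<pi> d ^ k * (\<Prod>l<k. 1 + (of_nat d - 2) * of_nat l / 2) / fact k"
proof
  fix k
  define u where "u = shifted_series c p"
  have sol: "formal_solution P u" using assms(4) by (simp add: u_def)
  have u0: "fps_nth u 0 = [:c, 1:]"
    by (simp add: u_def shifted_series_def assms(3) pcompose_pCons)
  have coeffP: "coeff P i = (if i \<le> d then \<pi> i else 0)" for i
    by (simp add: assms(1) coeff_sum)
  have degP: "degree P = d"
    by (rule antisym) (use assms(2) in \<open>auto intro!: degree_le le_degree simp: coeffP\<close>)
  have lc: "lead_coeff P = \<pi> d" by (simp add: degP coeffP)
  have "P \<noteq> 0" using lc assms(2) by auto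
  then have d2: "2 \<le> d" using formal_solution_degree_ge_2[OF sol u0] degP by simp
  define E where "E = k * (d - 2) + 1"
  have E: "int E = int k * (int d - 2) + 1" using d2 by (simp add: E_def)
  define L where "L = \<pi> d ^ k * (\<Prod>l<k. 1 + (of_nat d - 2) * of_nat l / 2) / fact k"
  define q where "q = fps_nth u k"
  have "degree_at_most q (int E)"
    using solution_below_line[OF sol u0] E
    by (simp add: below_line_def degP q_def mult.commute)
  moreover have top: "coeff q E = L"
  proof -
    have "fps_nth (symbol (int d - 2) 1 u) k = L"
      using solution_symbol[OF sol u0] lc by (simp add: degP symbol_solution_def L_def)
    then show ?thesis using E
      by (metis (no_types, lifting) symbol_def fps_nth_Abs_fps int_coeff_def mult.commute nat_int
          of_nat_0_le_iff q_def)
  qed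
  moreover have "L \<noteq> 0"
  proof -
    have "1 + (of_nat d - 2) * of_nat l / 2 \<noteq> (0 :: complex)" for l
    proof
      assume "1 + (of_nat d - 2) * of_nat l / 2 = (0 :: complex)"
      then have "of_nat (2 + (d - 2) * l) = (0 :: complex)"
        using d2 by (simp add: field_simps)
      then show False by (simp only: of_nat_eq_0_iff)
    qed
    then show ?thesis using assms(2) by (simp add: L_def)
  qed
  ultimately have deg: "degree q = E"
    by (metis antisym coeff_0 degree_at_most_iff le_degree of_nat_le_iff)
  have q: "q = pcompose (p k) [:c, 1:]" by (simp add: q_def u_def shifted_series_def)
  have degp: "degree (p k) = E" using deg by (simp add: q degree_pcompose)
  have "lead_coeff q = lead_coeff (p k)" unfolding q by (subst lead_coeff_comp) auto
  then have "coeff (p k) E = L" using top deg degp by simp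
  moreover have "p k \<noteq> 0" using calculation \<open>L \<noteq> 0\<close> by auto
  ultimately show "p k \<noteq> 0
      \<and> int (degree (p k)) = int k * (int d - 2) + 1
      \<and> coeff (p k) (nat (int k * (int d - 2) + 1)) =
          \<pi> d ^ k * (\<Prod>l<k. 1 + (of_nat d - 2) * of_nat l / 2) / fact k"
    using degp E by (simp add: L_def[symmetric] E[symmetric])
qed

end
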